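(* Let $T>0$, and let $\mathbf{P}:[0,T]\to\mathbb{R}^{(n_f+n_u)\times(n_f+n_u)}$ be the symmetric solution of the backward Riccati differential equation $$\frac{\mathrm{d}\mathbf{P}(t)}{\mathrm{d}t} = -\mathbf{A}^{\top}\mathbf{P}(t)-\mathbf{P}(t)\mathbf{A}+\mathbf{P}(t)\mathbf{M}\mathbf{U}^{-1}(t)\mathbf{M}^{\top}\mathbf{P}(t)-\mathbf{X}_g(t),\qquad \mathbf{P}(T)=\boldsymbol{\Phi}_g ,$$ partitioned conformally with $\mathbf{g}=(\mathbf{f},\mathbf{u})$ as $\mathbf{P}=\begin{pmatrix}\mathbf{P}_{11}&\mathbf{P}_{12}\\ \mathbf{P}_{21}&\mathbf{P}_{22}\end{pmatrix}$ with $\mathbf{P}_{21}=\mathbf{P}_{12}^{\top}$. Let $\hat{\mathbf{g}}(t)\in\mathbb{R}^{n_f+n_u}$ be the Kalman filter estimate of $\mathbf{g}(t)$. Then the control law $\mathbf{c}(t)=-\mathbf{U}^{-1}(t)\mathbf{M}^{\top}\mathbf{P}(t)\hat{\mathbf{g}}(t)$ can be written as $$\mathbf{c}(t)=-\begin{pmatrix}\mathbf{U}^{-1}(t)\mathbf{M}_f^{\top}\mathbf{P}_f(t) & \mathbf{U}^{-1}(t)\mathbf{M}_f^{\top}\mathbf{P}_{12}(t)\end{pmatrix}\hat{\mathbf{g}}(t),$$ where $\mathbf{P}_f(t):=\mathbf{P}_{11}(t)$ is the Riccati equation solution for the non-forced physical model (the first equation below with terminal value $\mathbf{P}_{11}(T)=\boldsymbol{\Phi}$),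 and the full set of equations for the blocks is $$\frac{\mathrm{d}\mathbf{P}_{11}}{\mathrm{d}t}=-\mathbf{A}_f^{\top}\mathbf{P}_{11}-\mathbf{P}_{11}\mathbf{A}_f+\mathbf{P}_{11}\mathbf{M}_f\mathbf{U}^{-1}\mathbf{M}_f^{\top}\mathbf{P}_{11}-\mathbf{X}(t),$$ $$\frac{\mathrm{d}\mathbf{P}_{12}}{\mathrm{d}t}=-\mathbf{A}_f^{\top}\mathbf{P}_{12}-\mathbf{P}_{11}\mathbf{B}_f\mathbf{C}_u-\mathbf{P}_{12}\mathbf{A}_u+\mathbf{P}_{11}\mathbf{M}_f\mathbf{U}^{-1}\mathbf{M}_f^{\top}\mathbf{P}_{12},$$ $$\frac{\mathrm{d}\mathbf{P}_{22}}{\mathrm{d}t}=-\mathbf{C}_u^{\top}\mathbf{B}_f^{\top}\mathbf{P}_{12}-\mathbf{A}_u^{\top}\mathbf{P}_{22}-\mathbf{P}_{21}\mathbf{B}_f\mathbf{C}_u-\mathbf{P}_{22}\mathbf{A}_u+\mathbf{P}_{12}^{\top}\mathbf{M}_f\mathbf{U}^{-1}\mathbf{M}_f^{\top}\mathbf{P}_{12}.$$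
   Context: A controlled latent force model has a physical part with state $\mathbf{f}(t)\in\mathbb{R}^{n_f}$ and a latent force part with state $\mathbf{u}(t)\in\mathbb{R}^{n_u}$: $$\dot{\mathbf{f}}=\mathbf{A}_f\mathbf{f}+\mathbf{B}_f\mathbf{C}_u\mathbf{u}+\mathbf{M}_f\mathbf{c},\qquad \dot{\mathbf{u}}=\mathbf{A}_u\mathbf{u}+\mathbf{B}_u\mathbf{w},$$ where $\mathbf{A}_f,\mathbf{B}_f,\mathbf{M}_f,\mathbf{A}_u,\mathbf{B}_u,\mathbf{C}_u$ are constant real matrices of compatible dimensions, $\mathbf{w}$ is white noise and $\mathbf{c}$ is the control. The augmented state is $\mathbf{g}=(\mathbf{f},\mathbf{u})$, with $$\mathbf{A}=\begin{pmatrix}\mathbf{A}_f&\mathbf{B}_f\mathbf{C}_u\\ \mathbf{0}&\mathbf{A}_u\end{pmatrix},\qquad \mathbf{M}=\begin{pmatrix}\mathbf{M}_f\\ \mathbf{0}\end{pmatrix}.$$ The quadratic cost is $$\mathcal{J}[\mathbf{c}]=\tfrac12\mathrm{E}\Big[\mathbf{f}^{\top}(T)\boldsymbol{\Phi}\mathbf{f}(T)+\int_0^T(\mathbf{f}^{\top}\mathbf{X}(t)\mathbf{f}+\mathbf{c}^{\top}\mathbf{U}(t)\mathbf{c})\,\mathrm{d}t\Big],$$ where $\boldsymbol{\Phi},\mathbf{X}(t)$ are symmetric positive semidefinite and $\mathbf{U}(t)$ is symmetric positive definite. In terms of $\mathbf{g}$ the weights are $\boldsymbol{\Phi}_g=\begin{pmatrix}\boldsymbol{\Phi}&\mathbf{0}\\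 \mathbf{0}&\mathbf{0}\end{pmatrix}$ and $\mathbf{X}_g(t)=\begin{pmatrix}\mathbf{X}(t)&\mathbf{0}\\ \mathbf{0}&\mathbf{0}\end{pmatrix}$. The Riccati equation of the non-forced physical model (i.e. of $\dot{\mathbf{f}}=\mathbf{A}_f\mathbf{f}+\mathbf{M}_f\mathbf{c}$ with the same cost) is $\dot{\mathbf{Q}}=-\mathbf{A}_f^{\top}\mathbf{Q}-\mathbf{Q}\mathbf{A}_f+\mathbf{Q}\mathbf{M}_f\mathbf{U}^{-1}(t)\mathbf{M}_f^{\top}\mathbf{Q}-\mathbf{X}(t)$ with $\mathbf{Q}(T)=\boldsymbol{\Phi}$. *)

theory Defs
  imports "HOL-Analysis.Analysis"
begin

text \<open>
  Block matrices are indexed by sum types: the augmented state \<open>(f, u)\<close> lives in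
  \<open>real ^ ('f + 'u)\<close>, with \<open>Inl\<close> selecting the physical and \<open>Inr\<close> the latent components.
\<close>

definition block_row :: "real ^ 'a ^ 'm \<Rightarrow> real ^ 'b ^ 'm \<Rightarrow> real ^ ('a + 'b) ^ 'm"
  where "block_row A B =
    (\<chi> i j. case j of Inl k \<Rightarrow> A $ i $ k | Inr l \<Rightarrow> B $ i $ l)"

definition block_col :: "real ^ 'n ^ 'a \<Rightarrow> real ^ 'n ^ 'b \<Rightarrow> real ^ 'n ^ ('a + 'b)"
  where "block_col A B = (\<chi> i. case i of Inl k \<Rightarrow> A $ k | Inr l \<Rightarrow> B $ l)"

definition block_matrix ::
  "real ^ 'a ^ 'c \<Rightarrow> real ^ 'b ^ 'c \<Rightarrow> real ^ 'a ^ 'd \<Rightarrow> real ^ 'b ^ 'd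
    \<Rightarrow> real ^ ('a + 'b) ^ ('c + 'd)"
  where "block_matrix A B C D = block_col (block_row A B) (block_row C D)"

definition sym_matrix :: "real ^ 'n ^ 'n \<Rightarrow> bool"
  where "sym_matrix S \<longleftrightarrow> transpose S = S"

definition sym_pos_semidef :: "real ^ 'n ^ 'n \<Rightarrow> bool"
  where "sym_pos_semidef S \<longleftrightarrow> sym_matrix S \<and> (\<forall>x. 0 \<le> x \<bullet> (S *v x))"

definition sym_pos_def :: "real ^ 'n ^ 'n \<Rightarrow> bool"
  where "sym_pos_def S \<longleftrightarrow> sym_matrix S \<and> (\<forall>x. x \<noteq> 0 \<longrightarrow> 0 < x \<bullet> (S *v x))"

text \<open>
  The backward Riccati equation of the system \<open>x' = A x + M c\<close> with weights \<open>X\<close>, \<open>U\<close> and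
  terminal weight \<open>\<Phi>\<close>. Derivatives at the end points of \<open>{0..T}\<close> are one-sided.
\<close>

definition riccati_solution ::
  "real \<Rightarrow> real ^ 'n ^ 'n \<Rightarrow> real ^ 'c ^ 'n \<Rightarrow> (real \<Rightarrow> real ^ 'c ^ 'c)
    \<Rightarrow> (real \<Rightarrow> real ^ 'n ^ 'n) \<Rightarrow> real ^ 'n ^ 'n \<Rightarrow> (real \<Rightarrow> real ^ 'n ^ 'n) \<Rightarrow> bool"
  where "riccati_solution T A M U X \<Phi> P \<longleftrightarrow>
    (\<forall>t\<in>{0..T}. (P has_vector_derivative
        - (transpose A ** P t) - P t ** A
        + P t ** M ** matrix_inv (U t) ** transpose M ** P t - X t) (at t within {0..T}))
    \<and> P T = \<Phi>"

text \<open>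
  Augmented matrices of the controlled latent force model
  \<open>f' = A\<^sub>f f + B\<^sub>f C\<^sub>u u + M\<^sub>f c\<close>, \<open>u' = A\<^sub>u u + B\<^sub>u w\<close>.
\<close>

definition lfm_A ::
  "real ^ 'f ^ 'f \<Rightarrow> real ^ 'k ^ 'f \<Rightarrow> real ^ 'u ^ 'k \<Rightarrow> real ^ 'u ^ 'u \<Rightarrow> real ^ ('f + 'u) ^ ('f + 'u)"
  where "lfm_A A\<^sub>f B\<^sub>f C\<^sub>u A\<^sub>u = block_matrix A\<^sub>f (B\<^sub>f ** C\<^sub>u) 0 A\<^sub>u"

definition lfm_M :: "real ^ 'c ^ 'f \<Rightarrow> real ^ 'c ^ ('f + 'u::finite)"
  where "lfm_M M\<^sub>f = block_col M\<^sub>f 0"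

definition lfm_weight :: "real ^ 'f ^ 'f \<Rightarrow> real ^ ('f + 'u::finite) ^ ('f + 'u)"
  where "lfm_weight W = block_matrix W 0 0 0"

text \<open>
  The control law fed with a state estimate. The identities concerning it are pointwise in the
  value of the estimate and independent of the measurement model, so in the main theorem the
  Kalman filter estimate (or any realisation of it) is an arbitrary vector-valued function of time.
\<close>

definition lq_control ::
  "real ^ 'c ^ 'n \<Rightarrow> (real \<Rightarrow> real ^ 'c ^ 'c) \<Rightarrow> (real \<Rightarrow> real ^ 'n ^ 'n)
    \<Rightarrow> (real \<Rightarrow> real ^ 'n) \<Rightarrow> real \<Rightarrow> real ^ 'c"
  where "lq_control M U P g_hat t = - ((matrix_inv (U t) ** transpose M ** P t) *v g_hat t)"

end

theory Submission
  imports Defs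
begin

text \<open>The control acts only on the physical block (\<open>lfm_M\<close> has a zero latent
  block) and the latent dynamics do not see the physical state (\<open>lfm_A\<close> is block upper
  triangular). Multiplying out the Riccati right-hand side blockwise, these zeros leave only
  \<open>P\<^sub>1\<^sub>1\<close> in the upper left block, so that block satisfies a closed
  equation, the Riccati equation without latent forces; the upper right block involves
  \<open>P\<^sub>1\<^sub>1\<close> and \<open>P\<^sub>1\<^sub>2\<close>. This computation is
  \<open>riccati_rhs_block\<close>. Since taking a block is a linear map, a derivative of the whole
  matrix gives a derivative of each block (\<open>has_vector_derivative_block_matrix\<close>). The
  same zero in \<open>lfm_M\<close> gives the form of the gain in
  \<open>lq_control_block\<close>.\<close>

lemma sum_UNIV_Plus:
  fixes h :: "'a::finite + 'b::finite \<Rightarrow> 'c::comm_monoid_add"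
  shows "sum h UNIV = (\<Sum>k\<in>UNIV. h (Inl k)) + (\<Sum>l\<in>UNIV. h (Inr l))"
  by (simp add: sum.Plus flip: UNIV_Plus_UNIV)

lemma zero_matrix_simps:
  fixes A :: "real ^ 'm ^ 'n"
  shows "transpose (0 :: real ^ 'm ^ 'n) = 0" "A ** (0 :: real ^ 'p ^ 'm) = 0"
    "(0 :: real ^ 'n ^ 'q) ** A = 0"
  by (simp_all add: transpose_def vec_eq_iff matrix_matrix_mult_def)

lemma block_row_component:
  "block_row A B $ i $ Inl k = A $ i $ k" "block_row A B $ i $ Inr l = B $ i $ l"
  by (simp_all add: block_row_def)

lemma block_col_component:
  "block_col A B $ Inl k = A $ k" "block_col A B $ Inr l = B $ l"
  by (simp_all add: block_col_def)

lemmas block_components = block_row_component block_col_component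

lemma block_matrix_eq_iff:
  "block_matrix A B C D = block_matrix A' B' C' D' \<longleftrightarrow> A = A' \<and> B = B' \<and> C = C' \<and> D = D'"
  by (auto simp: block_matrix_def vec_eq_iff split_sum_all block_components)

text \<open>Expanding a column times a row with \<open>matrix_mul_block_row\<close> and
  \<open>block_col_mul\<close> produces a row of columns; this folds it into
  \<open>block_matrix\<close>, which is defined as a column of rows.\<close>

lemma block_row_block_col: "block_row (block_col A C) (block_col B D) = block_matrix A B C D"
  by (simp add: block_matrix_def vec_eq_iff split_sum_all block_components)

lemma block_matrix_add:
  "block_matrix A B C D + block_matrix A' B' C' D' = block_matrix (A + A') (B + B') (C + C') (D + D')"
  by (simp add: block_matrix_def vec_eq_iff split_sum_all block_components)

lemma block_matrix_diff:
  "block_matrix A B C D - block_matrix A' B' C' D' = block_matrix (A - A') (B - B') (C - C') (D - D')"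
  by (simp add: block_matrix_def vec_eq_iff split_sum_all block_components)

lemma block_matrix_uminus: "- block_matrix A B C D = block_matrix (- A) (- B) (- C) (- D)"
  by (simp add: block_matrix_def vec_eq_iff split_sum_all block_components)

lemma transpose_block_col: "transpose (block_col A B) = block_row (transpose A) (transpose B)"
  by (simp add: vec_eq_iff split_sum_all transpose_def block_components)

lemma transpose_block_matrix:
  "transpose (block_matrix A B C D)
    = block_matrix (transpose A) (transpose C) (transpose B) (transpose D)"
  by (simp add: block_matrix_def vec_eq_iff split_sum_all transpose_def block_components)

lemma matrix_mul_block_row: "A ** block_row B C = block_row (A ** B) (A ** C)"
  by (simp add: vec_eq_iff split_sum_all matrix_matrix_mult_def block_components)

lemma block_col_mul: "block_col A B ** C = block_col (A ** C) (B ** C)"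
  by (simp add: vec_eq_iff split_sum_all matrix_matrix_mult_def block_components)

text \<open>Here the contracted index ranges over the sum type, so the sum in the matrix product
  splits into one sum per summand. All two-term entries in the later block products come from
  this.\<close>

lemma block_row_mul_block_col: "block_row A B ** block_col C D = A ** C + B ** D"
  by (simp add: vec_eq_iff matrix_matrix_mult_def block_components sum_UNIV_Plus)

lemma block_row_add: "block_row A B + block_row C D = block_row (A + C) (B + D)"
  by (simp add: vec_eq_iff split_sum_all block_components)

lemma block_row_mul_block_matrix:
  "block_row E F ** block_matrix A B C D = block_row (E ** A + F ** C) (E ** B + F ** D)"
  by (simp add: block_matrix_def block_row_mul_block_col matrix_mul_block_row block_row_add)

lemma block_matrix_mul_block_col:
  "block_matrix A B C D ** block_col E F = block_col (A ** E + B ** F) (C ** E + D ** F)"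
  by (simp add: block_matrix_def block_col_mul block_row_mul_block_col)

lemma block_matrix_mul:
  "block_matrix A B C D ** block_matrix A' B' C' D'
    = block_matrix (A ** A' + B ** C') (A ** B' + B ** D') (C ** A' + D ** C') (C ** B' + D ** D')"
  \<comment> \<open>Only the left factor is opened, so that each of its rows meets an intact
    \<open>block_matrix\<close>; the result is unfolded afterwards.\<close>
  unfolding block_matrix_def[of A B C D]
  by (simp add: block_col_mul block_row_mul_block_matrix) (simp add: block_matrix_def)

text \<open>Selecting entries is linear, and linear maps on a finite-dimensional space are bounded.
  With \<open>Inl\<close> or \<open>Inr\<close> for each of the two index maps this is the
  projection onto one of the four blocks.\<close>

lemma bounded_linear_reindex_matrix:
  fixes \<rho> :: "'a::finite \<Rightarrow> 'm::finite" and \<sigma> :: "'b::finite \<Rightarrow> 'n::finite"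
  shows "bounded_linear (\<lambda>Z :: real ^ 'n ^ 'm. \<chi> i j. Z $ \<rho> i $ \<sigma> j)"
  unfolding linear_conv_bounded_linear[symmetric]
  by (rule linearI) (simp_all add: vec_eq_iff)

lemma has_vector_derivative_block_matrix:
  fixes A :: "real \<Rightarrow> real ^ 'a::finite ^ 'c::finite" and B :: "real \<Rightarrow> real ^ 'b::finite ^ 'c"
    and C :: "real \<Rightarrow> real ^ 'a ^ 'd::finite" and D :: "real \<Rightarrow> real ^ 'b ^ 'd"
  assumes "((\<lambda>t. block_matrix (A t) (B t) (C t) (D t)) has_vector_derivative
      block_matrix A' B' C' D') F"
  shows "(A has_vector_derivative A') F" "(B has_vector_derivative B') F"
    "(C has_vector_derivative C') F" "(D has_vector_derivative D') F"
  using bounded_linear.has_vector_derivative[OF bounded_linear_reindex_matrix assms, of Inl Inl]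
    bounded_linear.has_vector_derivative[OF bounded_linear_reindex_matrix assms, of Inl Inr]
    bounded_linear.has_vector_derivative[OF bounded_linear_reindex_matrix assms, of Inr Inl]
    bounded_linear.has_vector_derivative[OF bounded_linear_reindex_matrix assms, of Inr Inr]
  by (simp_all add: block_matrix_def block_components)

text \<open>The row \<open>transpose (lfm_M M)\<close> vanishes on the latent part, so multiplying
  by it keeps only the upper block row of \<open>P t\<close>.\<close>

lemma lq_control_block:
  "lq_control (lfm_M M :: real ^ 'c ^ ('f::finite + 'u::finite)) U P g_hat t
    = - (block_row (matrix_inv (U t) ** transpose M ** P\<^sub>1\<^sub>1)
                   (matrix_inv (U t) ** transpose M ** P\<^sub>1\<^sub>2) *v g_hat t)"
  if "P t = block_matrix P\<^sub>1\<^sub>1 P\<^sub>1\<^sub>2 P\<^sub>2\<^sub>1 P\<^sub>2\<^sub>2"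
  unfolding lq_control_def lfm_M_def that
  by (simp add: transpose_block_col matrix_mul_block_row block_row_mul_block_matrix zero_matrix_simps)

text \<open>Pure block algebra, with \<open>V\<close> in the place of the inverse of
  \<open>U t\<close>. The zero block of \<open>lfm_A\<close> leaves
  \<open>transpose A\<^sub>f\<close> alone acting on the upper row and \<open>A\<^sub>f\<close>
  alone acting on the left column; the quadratic term is the left column of the block matrix times
  \<open>M ** V ** transpose M\<close> times its upper row.\<close>

lemma riccati_rhs_block:
  "- (transpose (lfm_A A\<^sub>f B\<^sub>f C\<^sub>u A\<^sub>u) ** block_matrix P\<^sub>1\<^sub>1 P\<^sub>1\<^sub>2 (transpose P\<^sub>1\<^sub>2) P\<^sub>2\<^sub>2)
     - block_matrix P\<^sub>1\<^sub>1 P\<^sub>1\<^sub>2 (transpose P\<^sub>1\<^sub>2) P\<^sub>2\<^sub>2 ** lfm_A A\<^sub>f B\<^sub>f C\<^sub>u A\<^sub>u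
     + block_matrix P\<^sub>1\<^sub>1 P\<^sub>1\<^sub>2 (transpose P\<^sub>1\<^sub>2) P\<^sub>2\<^sub>2 ** lfm_M M ** V ** transpose (lfm_M M)
         ** block_matrix P\<^sub>1\<^sub>1 P\<^sub>1\<^sub>2 (transpose P\<^sub>1\<^sub>2) P\<^sub>2\<^sub>2 - lfm_weight X
   = block_matrix
      (- (transpose A\<^sub>f ** P\<^sub>1\<^sub>1) - P\<^sub>1\<^sub>1 ** A\<^sub>f + P\<^sub>1\<^sub>1 ** M ** V ** transpose M ** P\<^sub>1\<^sub>1 - X)
      (- (transpose A\<^sub>f ** P\<^sub>1\<^sub>2) - P\<^sub>1\<^sub>1 ** B\<^sub>f ** C\<^sub>u - P\<^sub>1\<^sub>2 ** A\<^sub>u + P\<^sub>1\<^sub>1 ** M ** V ** transpose M ** P\<^sub>1\<^sub>2)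
      (- (transpose C\<^sub>u ** transpose B\<^sub>f ** P\<^sub>1\<^sub>1) - transpose A\<^sub>u ** transpose P\<^sub>1\<^sub>2
         - transpose P\<^sub>1\<^sub>2 ** A\<^sub>f + transpose P\<^sub>1\<^sub>2 ** M ** V ** transpose M ** P\<^sub>1\<^sub>1)
      (- (transpose C\<^sub>u ** transpose B\<^sub>f ** P\<^sub>1\<^sub>2) - transpose A\<^sub>u ** P\<^sub>2\<^sub>2
         - transpose P\<^sub>1\<^sub>2 ** B\<^sub>f ** C\<^sub>u - P\<^sub>2\<^sub>2 ** A\<^sub>u
         + transpose P\<^sub>1\<^sub>2 ** M ** V ** transpose M ** P\<^sub>1\<^sub>2)"
  unfolding lfm_A_def lfm_M_def lfm_weight_def
  by (simp add: transpose_block_matrix transpose_block_col block_matrix_mul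
      block_matrix_mul_block_col block_col_mul matrix_mul_block_row
      block_row_mul_block_matrix block_row_block_col block_matrix_add
      block_matrix_diff block_matrix_uminus block_matrix_eq_iff
      matrix_transpose_mul matrix_mul_assoc zero_matrix_simps algebra_simps)

theorem mainTheorem1:
  fixes T :: real
    and A\<^sub>f :: "real ^ 'f ^ 'f" and B\<^sub>f :: "real ^ 'k ^ 'f" and M\<^sub>f :: "real ^ 'c ^ 'f"
    and A\<^sub>u :: "real ^ 'u ^ 'u" and C\<^sub>u :: "real ^ 'u ^ 'k"
    and X :: "real \<Rightarrow> real ^ 'f ^ 'f" and U :: "real \<Rightarrow> real ^ 'c ^ 'c" and \<Phi> :: "real ^ 'f ^ 'f"
    and P :: "real \<Rightarrow> real ^ ('f + 'u) ^ ('f + 'u)"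
    and P\<^sub>1\<^sub>1 :: "real \<Rightarrow> real ^ 'f ^ 'f" and P\<^sub>1\<^sub>2 :: "real \<Rightarrow> real ^ 'u ^ 'f"
    and P\<^sub>2\<^sub>1 :: "real \<Rightarrow> real ^ 'f ^ 'u" and P\<^sub>2\<^sub>2 :: "real \<Rightarrow> real ^ 'u ^ 'u"
    and g_hat :: "real \<Rightarrow> real ^ ('f + 'u)"
  assumes "T > 0"
    and "sym_pos_semidef \<Phi>"
    and "\<And>t. t \<in> {0..T} \<Longrightarrow> sym_pos_semidef (X t)"
    and "\<And>t. t \<in> {0..T} \<Longrightarrow> sym_pos_def (U t)"
    and "riccati_solution T (lfm_A A\<^sub>f B\<^sub>f C\<^sub>u A\<^sub>u) (lfm_M M\<^sub>f) U
           (\<lambda>t. lfm_weight (X t)) (lfm_weight \<Phi>) P"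
    and "\<And>t. t \<in> {0..T} \<Longrightarrow> sym_matrix (P t)"
    and "\<And>t. t \<in> {0..T} \<Longrightarrow> P t = block_matrix (P\<^sub>1\<^sub>1 t) (P\<^sub>1\<^sub>2 t) (P\<^sub>2\<^sub>1 t) (P\<^sub>2\<^sub>2 t)"
  shows "(\<forall>t\<in>{0..T}. P\<^sub>2\<^sub>1 t = transpose (P\<^sub>1\<^sub>2 t))
    \<and> (\<forall>t\<in>{0..T}. lq_control (lfm_M M\<^sub>f) U P g_hat t
          = - (block_row (matrix_inv (U t) ** transpose M\<^sub>f ** P\<^sub>1\<^sub>1 t)
                         (matrix_inv (U t) ** transpose M\<^sub>f ** P\<^sub>1\<^sub>2 t) *v g_hat t))
    \<and> riccati_solution T A\<^sub>f M\<^sub>f U X \<Phi> P\<^sub>1\<^sub>1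
    \<and> (\<forall>t\<in>{0..T}. (P\<^sub>1\<^sub>1 has_vector_derivative
          - (transpose A\<^sub>f ** P\<^sub>1\<^sub>1 t) - P\<^sub>1\<^sub>1 t ** A\<^sub>f
          + P\<^sub>1\<^sub>1 t ** M\<^sub>f ** matrix_inv (U t) ** transpose M\<^sub>f ** P\<^sub>1\<^sub>1 t - X t)
          (at t within {0..T}))
    \<and> (\<forall>t\<in>{0..T}. (P\<^sub>1\<^sub>2 has_vector_derivative
          - (transpose A\<^sub>f ** P\<^sub>1\<^sub>2 t) - P\<^sub>1\<^sub>1 t ** B\<^sub>f ** C\<^sub>u - P\<^sub>1\<^sub>2 t ** A\<^sub>u
          + P\<^sub>1\<^sub>1 t ** M\<^sub>f ** matrix_inv (U t) ** transpose M\<^sub>f ** P\<^sub>1\<^sub>2 t)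
          (at t within {0..T}))
    \<and> (\<forall>t\<in>{0..T}. (P\<^sub>2\<^sub>2 has_vector_derivative
          - (transpose C\<^sub>u ** transpose B\<^sub>f ** P\<^sub>1\<^sub>2 t) - transpose A\<^sub>u ** P\<^sub>2\<^sub>2 t
          - P\<^sub>2\<^sub>1 t ** B\<^sub>f ** C\<^sub>u - P\<^sub>2\<^sub>2 t ** A\<^sub>u
          + transpose (P\<^sub>1\<^sub>2 t) ** M\<^sub>f ** matrix_inv (U t) ** transpose M\<^sub>f ** P\<^sub>1\<^sub>2 t)
          (at t within {0..T}))"
proof -
  let ?I = "{0..T}"
  \<comment> \<open>Compare the off-diagonal blocks in the symmetry of \<open>P t\<close>.\<close>
  have P21: "P\<^sub>2\<^sub>1 t = transpose (P\<^sub>1\<^sub>2 t)" if "t \<in> ?I" for t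
    using assms(6)[OF that] assms(7)[OF that]
    by (simp add: sym_matrix_def transpose_block_matrix block_matrix_eq_iff)
  let ?P = "\<lambda>t. block_matrix (P\<^sub>1\<^sub>1 t) (P\<^sub>1\<^sub>2 t) (transpose (P\<^sub>1\<^sub>2 t)) (P\<^sub>2\<^sub>2 t)"
  have Pt: "P t = ?P t" if "t \<in> ?I" for t
    using assms(7) P21 that by simp
  have "(?P has_vector_derivative
      - (transpose (lfm_A A\<^sub>f B\<^sub>f C\<^sub>u A\<^sub>u) ** ?P t) - ?P t ** lfm_A A\<^sub>f B\<^sub>f C\<^sub>u A\<^sub>u
      + ?P t ** lfm_M M\<^sub>f ** matrix_inv (U t) ** transpose (lfm_M M\<^sub>f) ** ?P t - lfm_weight (X t))
      (at t within ?I)" if "t \<in> ?I" for t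
    \<comment> \<open>\<open>P\<close> and its block form are known to agree only on the interval,
      which suffices because the derivative is taken within it.\<close>
    unfolding Pt[OF that, symmetric]
    by (rule has_vector_derivative_transform[OF that Pt[symmetric]])
      (use assms(5) that in \<open>auto simp: riccati_solution_def\<close>)
  \<comment> \<open>With the right-hand side in block form, the blocks can be compared: facts 1, 2
    and 4 are the equations for \<open>P\<^sub>1\<^sub>1\<close>, \<open>P\<^sub>1\<^sub>2\<close>
    and \<open>P\<^sub>2\<^sub>2\<close>.\<close>
  note deriv = has_vector_derivative_block_matrix[OF this[unfolded riccati_rhs_block]]
  have "P T = lfm_weight \<Phi>"
    using assms(5) by (simp add: riccati_solution_def)
  then have "P\<^sub>1\<^sub>1 T = \<Phi>"
    \<comment> \<open>Positivity of \<open>T\<close> puts \<open>T\<close> into the interval, where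
      the block form is available.\<close>
    using assms(1) Pt[of T] by (simp add: lfm_weight_def block_matrix_eq_iff)
  with deriv(1) have "riccati_solution T A\<^sub>f M\<^sub>f U X \<Phi> P\<^sub>1\<^sub>1"
    by (simp add: riccati_solution_def)
  then show ?thesis
    \<comment> \<open>\<open>P21\<close> reconciles the equation for
      \<open>P\<^sub>2\<^sub>2\<close>, derived with \<open>transpose (P\<^sub>1\<^sub>2 t)\<close>,
      with the claimed form containing \<open>P\<^sub>2\<^sub>1 t\<close>.\<close>
    using P21 deriv by (simp add: lq_control_block[where P = P, OF assms(7)])
qed

end
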